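(* For every integer $n\ge 2$, the domination polynomial of the flower graph $F_{4,n}$ satisfies \[ D(F_{4,n},x)=\big((1+x)^3+x\big)D(F_{4,n-1},x)-(1+3x)(x+3x^2+x^3)^{n-1}+(1+x)^3x^{n-1}-(x^2+x)(x^3+3x^2+3x)^{n-1}, \] where $D(F_{4,1},x)=x^4+4x^3+6x^2$.
   Context: All graphs are finite and simple. For a graph $G=(V,E)$, a set $S\subseteq V$ is dominating if every vertex of $V\setminus S$ is adjacent to a vertex of $S$. Let $d(G,i)$ be the number of dominating sets of $G$ of size $i$; the domination polynomial is $D(G,x)=\sum_{i=\gamma(G)}^{|V|} d(G,i)x^i$, where $\gamma(G)$ is the minimum size of a dominating set. For $q\ge 3$ and $n\ge 1$, the generalized friendship graph (flower) $F_{q,n}$ is the graph formed by $n$ cycles, each of order $q$, all sharing exactly one common vertex (and otherwise pairwise disjoint). In particular $F_{4,n}$ consists of $n$ copies of the $4$-cycle $C_4$ meeting at a single common vertex, and $F_{4,1}=C_4$. *)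

theory Defs
  imports "Graph_Theory.Pair_Digraph" "HOL-Computational_Algebra.Polynomial"
begin

text \<open>A finite simple graph is a \<^locale>\<open>pair_graph\<close>: each undirected edge is represented by
  the two opposite arcs between its endpoints.\<close>

definition dominating_set :: "'a pair_pre_digraph \<Rightarrow> 'a set \<Rightarrow> bool" where
  "dominating_set G S \<longleftrightarrow>
     S \<subseteq> pverts G \<and> (\<forall>v \<in> pverts G - S. \<exists>u \<in> S. (v, u) \<in> parcs G)"

definition num_dominating_sets :: "'a pair_pre_digraph \<Rightarrow> nat \<Rightarrow> nat" where
  "num_dominating_sets G i = card {S. dominating_set G S \<and> card S = i}"

definition domination_number :: "'a pair_pre_digraph \<Rightarrow> nat" where
  "domination_number G = (LEAST k. \<exists>S. dominating_set G S \<and> card S = k)"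

definition domination_poly :: "'a pair_pre_digraph \<Rightarrow> int poly" where
  "domination_poly G =
     (\<Sum>i = domination_number G..card (pverts G). monom (int (num_dominating_sets G i)) i)"

text \<open>The cycle \<open>f 0, f 1, \<dots>, f (q - 1), f 0\<close>; it has order \<open>q\<close> if \<open>f\<close> is injective
  on \<open>{..<q}\<close> and \<open>q \<ge> 3\<close>.\<close>

definition cycle_graph :: "nat \<Rightarrow> (nat \<Rightarrow> 'a) \<Rightarrow> 'a pair_pre_digraph" where
  "cycle_graph q f =
     \<lparr> pverts = f ` {..<q},
       parcs = (\<Union>j<q. {(f j, f (Suc j mod q)), (f (Suc j mod q), f j)}) \<rparr>"

text \<open>The vertex at position \<open>j\<close> of the \<open>i\<close>-th cycle of a flower; position \<open>0\<close> is the common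
  vertex \<^term>\<open>None\<close> of all the cycles.\<close>

definition petal_vertex :: "nat \<Rightarrow> nat \<Rightarrow> (nat \<times> nat) option" where
  "petal_vertex i j = (if j = 0 then None else Some (i, j))"

definition petal :: "nat \<Rightarrow> nat \<Rightarrow> (nat \<times> nat) option pair_pre_digraph" where
  "petal q i = cycle_graph q (petal_vertex i)"

definition flower :: "nat \<Rightarrow> nat \<Rightarrow> (nat \<times> nat) option pair_pre_digraph" where
  "flower q n =
     \<lparr> pverts = (\<Union>i<n. pverts (petal q i)), parcs = (\<Union>i<n. parcs (petal q i)) \<rparr>"

lemma inj_petal_vertex: "inj (petal_vertex i)"
  by (auto simp: inj_def petal_vertex_def split: if_splits)

lemma card_petal: "card (pverts (petal q i)) = q"
  by (simp add: petal_def cycle_graph_def card_image inj_on_subset[OF inj_petal_vertex])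

lemma petals_share_one_vertex:
  assumes "q > 0" "i \<noteq> j"
  shows "pverts (petal q i) \<inter> pverts (petal q j) = {None}"
  using assms by (auto simp: petal_def cycle_graph_def petal_vertex_def split: if_splits)

lemma flower_one: "flower q 1 = petal q 0"
  by (simp add: flower_def petal_def cycle_graph_def lessThan_Suc)

lemma pair_graph_flower:
  assumes "q \<ge> 3"
  shows "pair_graph (flower q n)"
proof
  have neq: "Suc j mod q \<noteq> j" if "j < q" for j
    using that assms by (cases "Suc j = q") auto
  show "fst e \<noteq> snd e" if "e \<in> parcs (flower q n)" for e
    using that neq
    by (fastforce simp: flower_def petal_def cycle_graph_def inj_eq[OF inj_petal_vertex])
  have mem: "\<exists>k\<in>{..<n}. petal_vertex i j \<in> petal_vertex k ` {..<q}" if "i < n" "j < q" for i j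
    using that by blast
  show "fst e \<in> pverts (flower q n)" "snd e \<in> pverts (flower q n)"
    if "e \<in> parcs (flower q n)" for e
    using that assms by (auto simp: flower_def petal_def cycle_graph_def intro!: mem)
qed (auto simp: flower_def petal_def cycle_graph_def symmetric_def sym_def)

end

theory Submission
  imports Defs
begin

text \<open>Write \<open>c\<close> for the common vertex of \<open>F\<^sub>4\<^sub>,\<^sub>n\<close> and split the dominating sets \<open>S\<close> by
  whether \<open>c \<in> S\<close>. If \<open>c \<in> S\<close>, the condition on \<open>S\<close> decouples over the cycles: on each of
  them \<open>S\<close> meets the other three vertices, which has weight \<open>A = x\<^sup>3 + 3x\<^sup>2 + 3x\<close>. If
  \<open>c \<notin> S\<close>, then on each cycle \<open>S\<close> contains the vertex opposite to \<open>c\<close> or both neighbours of \<open>c\<close>,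
  which has weight \<open>B = x + 3x\<^sup>2 + x\<^sup>3\<close>; such a choice dominates \<open>c\<close> unless \<open>S\<close> consists of
  the \<open>n\<close> opposite vertices. Hence \<open>D(F\<^sub>4\<^sub>,\<^sub>n, x) = x A\<^sup>n + B\<^sup>n - x\<^sup>n\<close>, and the recurrence follows from
  \<open>(1 + x)\<^sup>3 + x = A + 1 + x = B + 1 + 3x\<close>.\<close>

section \<open>Generating functions by cardinality\<close>

text \<open>Grouping the dominating sets by size gives the coefficients. The bounds of the defining
  sum cut nothing off, since every dominating set has a size between them.\<close>

lemma domination_poly_eq_sum:
  assumes "finite (pverts G)"
  shows "domination_poly G = (\<Sum>S | dominating_set G S. [:0, 1:] ^ card S)"
proof -
  have sub: "{S. dominating_set G S} \<subseteq> Pow (pverts G)"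
    by (auto simp: dominating_set_def)
  then have fin: "finite {S. dominating_set G S}"
    using assms by (simp add: finite_subset)
  have range: "card ` {S. dominating_set G S} \<subseteq> {domination_number G..card (pverts G)}"
  proof (rule image_subsetI)
    fix S assume S: "S \<in> {S. dominating_set G S}"
    then have "domination_number G \<le> card S"
      unfolding domination_number_def by (blast intro: Least_le)
    moreover have "card S \<le> card (pverts G)"
      using S sub assms by (intro card_mono) auto
    ultimately show "card S \<in> {domination_number G..card (pverts G)}"
      by simp
  qed
  have "domination_poly G = (\<Sum>i = domination_number G..card (pverts G).
      \<Sum>S | S \<in> {S. dominating_set G S} \<and> card S = i. [:0, 1:] ^ card S)"
    unfolding domination_poly_def num_dominating_sets_def
  proof (rule sum.cong)
    fix i
    have "(\<Sum>S | dominating_set G S \<and> card S = i. [:0, 1::int:] ^ card S) =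
        (\<Sum>S | dominating_set G S \<and> card S = i. [:0, 1:] ^ i)"
      by (rule sum.cong) auto
    then show "monom (int (card {S. dominating_set G S \<and> card S = i})) i =
        (\<Sum>S | S \<in> {S. dominating_set G S} \<and> card S = i. [:0, 1:] ^ card S)"
      by (simp add: monom_altdef of_nat_mult_conv_smult)
  qed simp
  also have "\<dots> = (\<Sum>S | dominating_set G S. [:0, 1:] ^ card S)"
    by (rule sum.group[OF fin _ range]) simp
  finally show ?thesis .
qed

lemma sum_power_card_relations:
  fixes x :: "'c::comm_semiring_1"
  assumes "finite I" "finite F" "\<And>U. U \<in> F \<Longrightarrow> finite U"
  shows "(\<Sum>T | Domain T \<subseteq> I \<and> (\<forall>i\<in>I. T `` {i} \<in> F). x ^ card T) =
    (\<Sum>U\<in>F. x ^ card U) ^ card I"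
proof -
  have "(\<Sum>T | Domain T \<subseteq> I \<and> (\<forall>i\<in>I. T `` {i} \<in> F). x ^ card T) =
      (\<Sum>f\<in>PiE I (\<lambda>_. F). \<Prod>i\<in>I. x ^ card (f i))"
  proof (rule sum.reindex_bij_witness[where i = "\<lambda>f. Sigma I f"
        and j = "\<lambda>T. \<lambda>i\<in>I. T `` {i}"])
    fix T assume T: "T \<in> {T. Domain T \<subseteq> I \<and> (\<forall>i\<in>I. T `` {i} \<in> F)}"
    show eq: "Sigma I (\<lambda>i\<in>I. T `` {i}) = T"
      using T by auto
    have "card (Sigma I (\<lambda>i\<in>I. T `` {i})) = (\<Sum>i\<in>I. card ((\<lambda>i\<in>I. T `` {i}) i))"
      using T assms by (intro card_SigmaI) auto
    then show "(\<Prod>i\<in>I. x ^ card ((\<lambda>i\<in>I. T `` {i}) i)) = x ^ card T"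
      unfolding eq by (simp only: power_sum)
  next
    fix f assume f: "f \<in> PiE I (\<lambda>_. F)"
    have fib: "Sigma I f `` {i} = f i" if "i \<in> I" for i
      using that by auto
    show "(\<lambda>i\<in>I. Sigma I f `` {i}) = f"
      using f fib by (auto simp: fun_eq_iff PiE_def extensional_def)
    show "Sigma I f \<in> {T. Domain T \<subseteq> I \<and> (\<forall>i\<in>I. T `` {i} \<in> F)}"
      using f fib by (auto simp: PiE_iff)
  qed (auto simp: PiE_iff)
  also have "\<dots> = (\<Prod>i\<in>I. \<Sum>U\<in>F. x ^ card U)"
    using assms by (intro prod_sum_PiE[symmetric]) auto
  finally show ?thesis by simp
qed

section \<open>Dominating sets of the flower\<close>

text \<open>The bound on \<open>n\<close> matters: without any cycle the flower has no common vertex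
  either.\<close>

lemma pverts_flower_4:
  assumes "n \<ge> 1"
  shows "pverts (flower 4 n) = insert None (Some ` ({..<n} \<times> {1, 2, 3}))"
  using assms lessThan_empty_iff[of n]
  by (auto simp: flower_def petal_def cycle_graph_def petal_vertex_def lessThan_nat_numeral
      lessThan_Suc)

lemma parcs_flower_4:
  "parcs (flower 4 n) = (\<Union>i<n.
     {(None, Some (i, 1)), (Some (i, 1), None), (Some (i, 1), Some (i, 2)), (Some (i, 2), Some (i, 1)),
      (Some (i, 2), Some (i, 3)), (Some (i, 3), Some (i, 2)), (Some (i, 3), None), (None, Some (i, 3))})"
  by (auto simp: flower_def petal_def cycle_graph_def petal_vertex_def lessThan_nat_numeral
      lessThan_Suc)

text \<open>The possible traces of a dominating set on the positions 1, 2, 3 of a cycle, according to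
  whether it contains the common vertex.\<close>

definition centre_petal_sets :: "nat set set" where
  "centre_petal_sets = {{1}, {2}, {3}, {1, 2}, {1, 3}, {2, 3}, {1, 2, 3}}"

definition no_centre_petal_sets :: "nat set set" where
  "no_centre_petal_sets = {{2}, {1, 2}, {1, 3}, {2, 3}, {1, 2, 3}}"

text \<open>Links the two descriptions of the trace families: explicit lists, over which weights can
  be summed, and conditions, to which domination reduces.\<close>

lemma subset_123_iff:
  "U \<subseteq> {1, 2, 3 :: nat} \<longleftrightarrow> U \<in> {{}, {1}, {2}, {3}, {1, 2}, {1, 3}, {2, 3}, {1, 2, 3}}"
  unfolding Pow_iff[symmetric] Pow_insert Pow_empty
  by (simp add: image_Un) argo

lemma centre_petal_sets_iff:
  "U \<in> centre_petal_sets \<longleftrightarrow> U \<subseteq> {1, 2, 3} \<and> U \<noteq> {}"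
  unfolding centre_petal_sets_def subset_123_iff
  by (simp add: conj_disj_distribR cong: conj_cong)

lemma no_centre_petal_sets_iff:
  "U \<in> no_centre_petal_sets \<longleftrightarrow> U \<subseteq> {1, 2, 3} \<and> (2 \<in> U \<or> {1, 3} \<subseteq> U)"
  unfolding no_centre_petal_sets_def subset_123_iff
  by (simp add: conj_disj_distribR cong: conj_cong)

text \<open>Each vertex demands that \<open>S\<close> meet its closed neighbourhood: first the
  common vertex, then positions 1, 2 and 3 of every cycle.\<close>

lemma dominating_set_flower_4_iff:
  assumes "n \<ge> 1"
  shows "dominating_set (flower 4 n) S \<longleftrightarrow>
    S \<subseteq> insert None (Some ` ({..<n} \<times> {1, 2, 3})) \<and>
    (None \<in> S \<or> (\<exists>i<n. Some (i, 1) \<in> S \<or> Some (i, 3) \<in> S)) \<and>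
    (\<forall>i<n. (Some (i, 1) \<in> S \<or> None \<in> S \<or> Some (i, 2) \<in> S) \<and>
      (Some (i, 2) \<in> S \<or> Some (i, 1) \<in> S \<or> Some (i, 3) \<in> S) \<and>
      (Some (i, 3) \<in> S \<or> None \<in> S \<or> Some (i, 2) \<in> S))"
proof -
  have dom: "(\<forall>v\<in>insert None (Some ` ({..<n} \<times> {1, 2, 3})) - S. P v) \<longleftrightarrow>
      (None \<in> S \<or> P None) \<and> (\<forall>i<n. (Some (i, 1) \<in> S \<or> P (Some (i, 1))) \<and>
      (Some (i, 2) \<in> S \<or> P (Some (i, 2))) \<and> (Some (i, 3) \<in> S \<or> P (Some (i, 3))))" for P
    by auto
  have adj: "(\<exists>u\<in>S. (None, u) \<in> parcs (flower 4 n)) \<longleftrightarrow>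
      (\<exists>i<n. Some (i, 1) \<in> S \<or> Some (i, 3) \<in> S)"
    "\<And>i. i < n \<Longrightarrow> (\<exists>u\<in>S. (Some (i, 1), u) \<in> parcs (flower 4 n)) \<longleftrightarrow> None \<in> S \<or> Some (i, 2) \<in> S"
    "\<And>i. i < n \<Longrightarrow> (\<exists>u\<in>S. (Some (i, 2), u) \<in> parcs (flower 4 n)) \<longleftrightarrow> Some (i, 1) \<in> S \<or> Some (i, 3) \<in> S"
    "\<And>i. i < n \<Longrightarrow> (\<exists>u\<in>S. (Some (i, 3), u) \<in> parcs (flower 4 n)) \<longleftrightarrow> None \<in> S \<or> Some (i, 2) \<in> S"
    by (auto simp: parcs_flower_4)
  show ?thesis
    unfolding dominating_set_def pverts_flower_4[OF assms] dom
    by (simp only: adj cong: imp_cong)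
qed

text \<open>Brings conditions on \<open>T\<close> into the row-wise form that
  \<open>sum_power_card_relations\<close> expects.\<close>

lemma subset_Times_iff_Image:
  "T \<subseteq> I \<times> V \<longleftrightarrow> Domain T \<subseteq> I \<and> (\<forall>i\<in>I. T `` {i} \<subseteq> V)"
  by auto

text \<open>The common vertex dominates positions 1 and 3, so only position 2 imposes a condition,
  and its closed neighbourhood is the whole row.\<close>

lemma dominating_set_flower_4_insert_centre:
  assumes "n \<ge> 1"
  shows "dominating_set (flower 4 n) (insert None (Some ` T)) \<longleftrightarrow>
    Domain T \<subseteq> {..<n} \<and> (\<forall>i\<in>{..<n}. T `` {i} \<in> centre_petal_sets)"
proof -
  have "dominating_set (flower 4 n) (insert None (Some ` T)) \<longleftrightarrow>
      T \<subseteq> {..<n} \<times> {1, 2, 3} \<and> (\<forall>i<n. (i, 2) \<in> T \<or> (i, 1) \<in> T \<or> (i, 3) \<in> T)"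
    unfolding dominating_set_flower_4_iff[OF assms] by auto
  also have "\<dots> \<longleftrightarrow> T \<subseteq> {..<n} \<times> {1, 2, 3} \<and> (\<forall>i<n. T `` {i} \<noteq> {})"
    by blast
  finally show ?thesis
    unfolding subset_Times_iff_Image centre_petal_sets_iff by auto
qed

text \<open>The conditions at positions 1 and 3 amount to 2 or both 1 and 3, which also covers
  position 2. The common vertex adds the only condition linking different cycles.\<close>

lemma dominating_set_flower_4_no_centre:
  assumes "n \<ge> 1"
  shows "dominating_set (flower 4 n) (Some ` T) \<longleftrightarrow>
    Domain T \<subseteq> {..<n} \<and> (\<forall>i\<in>{..<n}. T `` {i} \<in> no_centre_petal_sets) \<and> T \<noteq> {..<n} \<times> {2}"
proof -
  have "dominating_set (flower 4 n) (Some ` T) \<longleftrightarrow>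
      T \<subseteq> {..<n} \<times> {1, 2, 3} \<and> (\<forall>i<n. (i, 2) \<in> T \<or> (i, 1) \<in> T \<and> (i, 3) \<in> T) \<and>
      (\<exists>i<n. (i, 1) \<in> T \<or> (i, 3) \<in> T)"
  proof -
    have "Some ` T \<subseteq> insert None (Some ` X) \<longleftrightarrow> T \<subseteq> X" for X
      by auto
    then show ?thesis
      unfolding dominating_set_flower_4_iff[OF assms]
      by (simp add: inj_image_mem_iff) blast
  qed
  also have "\<dots> \<longleftrightarrow> T \<subseteq> {..<n} \<times> {1, 2, 3} \<and>
      (\<forall>i<n. (i, 2) \<in> T \<or> (i, 1) \<in> T \<and> (i, 3) \<in> T) \<and> T \<noteq> {..<n} \<times> {2}"
  proof (intro conj_cong refl)
    assume T: "T \<subseteq> {..<n} \<times> {1, 2, 3}" "\<forall>i<n. (i, 2) \<in> T \<or> (i, 1) \<in> T \<and> (i, 3) \<in> T"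
    show "(\<exists>i<n. (i, 1) \<in> T \<or> (i, 3) \<in> T) \<longleftrightarrow> T \<noteq> {..<n} \<times> {2}"
    proof
      \<comment> \<open>If no row contained 1 or 3, the row condition would put 2 in every row,
        leaving exactly the excluded relation.\<close>
      assume "T \<noteq> {..<n} \<times> {2}"
      then show "\<exists>i<n. (i, 1) \<in> T \<or> (i, 3) \<in> T"
        using T by blast
    qed auto
  qed
  finally show ?thesis
    unfolding subset_Times_iff_Image no_centre_petal_sets_iff by auto
qed

section \<open>Closed form and recurrence\<close>

lemma domination_poly_flower_4:
  fixes n :: nat and x :: "int poly"
  defines "x \<equiv> [:0, 1:]"
  assumes "n \<ge> 1"
  shows "domination_poly (flower 4 n) =
    x * (x ^ 3 + 3 * x ^ 2 + 3 * x) ^ n + (x + 3 * x ^ 2 + x ^ 3) ^ n - x ^ n"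
proof -
  define C where "C = {T. Domain T \<subseteq> {..<n} \<and> (\<forall>i\<in>{..<n}. T `` {i} \<in> centre_petal_sets)}"
  define N where "N = {T. Domain T \<subseteq> {..<n} \<and> (\<forall>i\<in>{..<n}. T `` {i} \<in> no_centre_petal_sets)}"
  \<comment> \<open>The one choice in \<open>N\<close> that leaves the common vertex undominated; it
    accounts for the term \<open>- x ^ n\<close>.\<close>
  define T2 where "T2 = {..<n} \<times> {2::nat}"
  have sub: "T \<subseteq> {..<n} \<times> {1, 2, 3}" if "T \<in> C \<union> N" for T
  proof -
    have "Domain T \<subseteq> {..<n}"
      using that by (elim UnE) (simp_all only: C_def N_def mem_Collect_eq)
    moreover have "T `` {i} \<subseteq> {1, 2, 3}" if "i \<in> {..<n}" for i
    proof -
      have "T `` {i} \<in> centre_petal_sets \<or> T `` {i} \<in> no_centre_petal_sets"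
        using that \<open>T \<in> C \<union> N\<close> by (elim UnE) (simp_all only: C_def N_def mem_Collect_eq, simp_all)
      then show ?thesis
        unfolding centre_petal_sets_iff no_centre_petal_sets_iff by (elim disjE conjE)
    qed
    ultimately show ?thesis
      unfolding subset_Times_iff_Image by (intro conjI ballI)
  qed
  then have "C \<union> N \<subseteq> Pow ({..<n} \<times> {1, 2, 3})"
    by (metis PowI subsetI)
  then have "finite (C \<union> N)"
    by (rule finite_subset) simp
  then have fin: "finite C" "finite N"
    by simp_all
  have finT: "finite T" if "T \<in> C" for T
    by (rule finite_subset[OF sub]) (use that in simp_all)
  have "T2 \<in> N"
    by (auto simp: N_def T2_def no_centre_petal_sets_iff)
  have insert_eq: "insert None (Some ` T) = insert None (Some ` T') \<longleftrightarrow> T = T'"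
    for T T' :: "(nat \<times> nat) set"
    by (subst insert_ident) (auto simp: inj_image_eq_iff)
  have split: "{S. dominating_set (flower 4 n) S} =
      (\<lambda>T. insert None (Some ` T)) ` C \<union> (\<lambda>T. Some ` T) ` (N - {T2})" (is "?L = ?R")
  proof (intro set_eqI)
    fix S :: "(nat \<times> nat) option set"
    define T where "T = Some -` S"
    have T: "Some ` T = S - {None}"
      unfolding T_def image_vimage_eq using notin_range_Some by blast
    show "S \<in> ?L \<longleftrightarrow> S \<in> ?R"
    proof (cases "None \<in> S")
      case True
      then have S: "S = insert None (Some ` T)"
        by (simp add: T insert_absorb)
      have "S \<in> ?R \<longleftrightarrow> T \<in> C"
        unfolding S by (auto simp: image_iff inj_image_eq_iff insert_eq)
      then show ?thesis
        unfolding S using dominating_set_flower_4_insert_centre[OF \<open>n \<ge> 1\<close>] C_def by simp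
    next
      case False
      then have S: "S = Some ` T"
        by (simp add: T)
      have "S \<in> ?R \<longleftrightarrow> T \<in> N - {T2}"
        unfolding S by (auto simp: image_iff inj_image_eq_iff)
      then show ?thesis
        unfolding S using dominating_set_flower_4_no_centre[OF \<open>n \<ge> 1\<close>] N_def T2_def by simp
    qed
  qed
  \<comment> \<open>Summing over a listed family term by term requires its members to be distinct;
    pairs and the triple differ in cardinality.\<close>
  have triple_neq: "{1, 2} \<noteq> {1, 2, 3 :: nat}" "{1, 3} \<noteq> {1, 2, 3 :: nat}" "{2, 3} \<noteq> {1, 2, 3 :: nat}"
    by (rule notI; drule arg_cong[of _ _ card]; simp)+
  have C: "(\<Sum>T\<in>C. x ^ card T) = (x ^ 3 + 3 * x ^ 2 + 3 * x) ^ n"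
  proof -
    have "(\<Sum>T\<in>C. x ^ card T) = (\<Sum>U\<in>centre_petal_sets. x ^ card U) ^ n"
      unfolding C_def
      by (subst sum_power_card_relations) (auto simp: centre_petal_sets_def)
    also have "(\<Sum>U\<in>centre_petal_sets. x ^ card U) = x ^ 3 + 3 * x ^ 2 + 3 * x"
      unfolding centre_petal_sets_def
      by (simp add: doubleton_eq_iff triple_neq power2_eq_square power3_eq_cube del: One_nat_def)
    finally show ?thesis .
  qed
  have N: "(\<Sum>T\<in>N. x ^ card T) = (x + 3 * x ^ 2 + x ^ 3) ^ n"
  proof -
    have "(\<Sum>T\<in>N. x ^ card T) = (\<Sum>U\<in>no_centre_petal_sets. x ^ card U) ^ n"
      unfolding N_def
      by (subst sum_power_card_relations) (auto simp: no_centre_petal_sets_def)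
    also have "(\<Sum>U\<in>no_centre_petal_sets. x ^ card U) = x + 3 * x ^ 2 + x ^ 3"
      unfolding no_centre_petal_sets_def
      by (simp add: doubleton_eq_iff triple_neq power2_eq_square power3_eq_cube del: One_nat_def)
    finally show ?thesis .
  qed
  have "finite (pverts (flower 4 n))"
    using pverts_flower_4[OF \<open>n \<ge> 1\<close>] by simp
  then have "domination_poly (flower 4 n) =
      (\<Sum>S\<in>(\<lambda>T. insert None (Some ` T)) ` C \<union> (\<lambda>T. Some ` T) ` (N - {T2}). x ^ card S)"
    unfolding x_def by (simp only: domination_poly_eq_sum split)
  also have "\<dots> = (\<Sum>S\<in>(\<lambda>T. insert None (Some ` T)) ` C. x ^ card S) +
      (\<Sum>S\<in>(\<lambda>T. Some ` T) ` (N - {T2}). x ^ card S)"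
    using fin by (intro sum.union_disjoint) auto
  \<comment> \<open>The common vertex adds one element to a finite set, hence a factor
    \<open>x\<close>.\<close>
  also have "(\<Sum>S\<in>(\<lambda>T. insert None (Some ` T)) ` C. x ^ card S) = (\<Sum>T\<in>C. x * x ^ card T)"
    by (subst sum.reindex)
      (auto simp: inj_on_def insert_eq finT card_image intro!: sum.cong)
  also have "\<dots> = x * (x ^ 3 + 3 * x ^ 2 + 3 * x) ^ n"
    by (simp add: C flip: sum_distrib_left)
  also have "(\<Sum>S\<in>(\<lambda>T. Some ` T) ` (N - {T2}). x ^ card S) = (\<Sum>T\<in>N - {T2}. x ^ card T)"
    by (subst sum.reindex) (auto simp: inj_on_def inj_image_eq_iff card_image)
  also have "\<dots> = (x + 3 * x ^ 2 + x ^ 3) ^ n - x ^ n"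
    using fin \<open>T2 \<in> N\<close> by (simp add: sum_diff1 N) (simp add: T2_def)
  finally show ?thesis by simp
qed

theorem theorem2p4:
  shows "let x = [:0, 1:] :: int poly in
         (\<forall>n\<ge>2. domination_poly (flower 4 n) =
            ((1 + x) ^ 3 + x) * domination_poly (flower 4 (n - 1))
            - (1 + 3 * x) * (x + 3 * x ^ 2 + x ^ 3) ^ (n - 1)
            + (1 + x) ^ 3 * x ^ (n - 1)
            - (x ^ 2 + x) * (x ^ 3 + 3 * x ^ 2 + 3 * x) ^ (n - 1))
         \<and> domination_poly (flower 4 1) = x ^ 4 + 4 * x ^ 3 + 6 * x ^ 2"
proof -
  define x :: "int poly" where "x = [:0, 1:]"
  note closed = domination_poly_flower_4[folded x_def]
  have "domination_poly (flower 4 n) =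
      ((1 + x) ^ 3 + x) * domination_poly (flower 4 (n - 1))
      - (1 + 3 * x) * (x + 3 * x ^ 2 + x ^ 3) ^ (n - 1)
      + (1 + x) ^ 3 * x ^ (n - 1)
      - (x ^ 2 + x) * (x ^ 3 + 3 * x ^ 2 + 3 * x) ^ (n - 1)" if n: "n \<ge> 2" for n
  proof -
    define m where "m = n - 1"
    then have m: "n = Suc m" "m \<ge> 1" "n \<ge> 1"
      using n by simp_all
    \<comment> \<open>With arbitrary \<open>a\<close>, \<open>b\<close>, \<open>c\<close> in place
      of the powers \<open>A ^ m\<close>, \<open>B ^ m\<close>, \<open>x ^ m\<close>, the recurrence
      becomes a plain polynomial identity without symbolic exponents.\<close>
    have "x * (A * a) + B * b - x * c = ((1 + x) ^ 3 + x) * (x * a + b - c)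
        - (1 + 3 * x) * b + (1 + x) ^ 3 * c - (x ^ 2 + x) * a"
      if "A = x ^ 3 + 3 * x ^ 2 + 3 * x" "B = x + 3 * x ^ 2 + x ^ 3" for A B a b c
      unfolding that by algebra
    then show ?thesis
      unfolding m_def[symmetric] closed[OF m(2)] closed[OF m(3)] unfolding m(1) power_Suc
      by blast
  qed
  moreover have "domination_poly (flower 4 1) = x ^ 4 + 4 * x ^ 3 + 6 * x ^ 2"
    unfolding closed[OF order_refl] by algebra
  ultimately show ?thesis
    unfolding Let_def x_def by blast
qed

end
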